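(* Let $k,c_1,c_2,\gamma>0$ and consider the system $$\dot{z}_1=z_2,\qquad \dot{z}_2=-k z_2-c_1\nabla F(z_1)-c_2\nabla F(z_1+\gamma z_2),$$ where $z_1,z_2\in\mathbb{R}^n$. Suppose that $F:\mathbb{R}^n\to\mathbb{R}$, $F\in\mathcal{C}^1$, is convex on an open convex set $\mathcal{D}\subseteq\mathbb{R}^n$ and has a unique isolated minimum on $\mathcal{D}$ at $z^*\in\mathcal{D}$. Then the equilibrium $(z_1,z_2)=(z^*,0)$ of the system is locally asymptotically stable. Moreover, if $\mathcal{D}=\mathbb{R}^n$ and $F$ is radially unbounded, then the equilibrium $(z^*,0)$ is globally asymptotically stable.
   Context: $\mathcal{C}^1$ denotes the continuously differentiable functions and $\nabla F$ the gradient (column vector) of $F$. $F$ is radially unbounded if $F(z)\to\infty$ as $\|z\|\to\infty$. Asymptotic stability is in the sense of Lyapunov. *)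

theory Defs
  imports "HOL-Analysis.Analysis"
begin

definition gradient :: "('a::euclidean_space \<Rightarrow> real) \<Rightarrow> 'a \<Rightarrow> 'a" where
  "gradient F x = (THE D. GDERIV F x :> D)"

lemma GDERIV_gradient:
  fixes F :: "'a::euclidean_space \<Rightarrow> real"
  assumes "F differentiable at x"
  shows "GDERIV F x :> gradient F x"
proof -
  obtain F' where F': "(F has_derivative F') (at x)"
    using assms by (auto simp: differentiable_def)
  define D where "D = adjoint F' 1"
  have lin: "linear F'"
    using F' by (rule has_derivative_linear)
  have "h \<bullet> D = F' h" for h
    using adjoint_works[OF lin, of h 1] by (simp add: D_def)
  then have D: "GDERIV F x :> D"
    using F' by (simp add: gderiv_def)
  have "E = D" if "GDERIV F x :> E" for E
  proof -
    have "(\<lambda>h. h \<bullet> E) = (\<lambda>h. h \<bullet> D)"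
      using that D unfolding gderiv_def by (rule has_derivative_unique)
    then have "h \<bullet> E = h \<bullet> D" for h
      by (rule fun_cong)
    then show ?thesis
      using vector_eq_ldot[of E D] by blast
  qed
  then show ?thesis
    unfolding gradient_def using D by (rule theI[rotated])
qed

definition C1 :: "('a::euclidean_space \<Rightarrow> real) \<Rightarrow> bool" where
  "C1 F \<longleftrightarrow> (\<forall>x. F differentiable at x) \<and> continuous_on UNIV (gradient F)"

text \<open>
  Solutions of the autonomous equation \<open>x' = f x\<close> on a time interval \<open>J\<close> starting at time 0. The
  vector field is not assumed to be Lipschitz, so that several solutions may share an initial value;
  the stability notions below therefore quantify over all solutions.
\<close>

definition solution :: "('a::real_normed_vector \<Rightarrow> 'a) \<Rightarrow> (real \<Rightarrow> 'a) \<Rightarrow> real set \<Rightarrow> bool" where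
  "solution f x J \<longleftrightarrow> is_interval J \<and> 0 \<in> J \<and> J \<subseteq> {0..} \<and>
     (\<forall>t\<in>J. (x has_vector_derivative f (x t)) (at t within J))"

definition maximal_solution :: "('a::real_normed_vector \<Rightarrow> 'a) \<Rightarrow> (real \<Rightarrow> 'a) \<Rightarrow> real set \<Rightarrow> bool" where
  "maximal_solution f x J \<longleftrightarrow> solution f x J \<and>
     (\<forall>y K. solution f y K \<and> J \<subseteq> K \<and> (\<forall>t\<in>J. y t = x t) \<longrightarrow> K = J)"

definition equilibrium :: "('a::real_normed_vector \<Rightarrow> 'a) \<Rightarrow> 'a \<Rightarrow> bool" where
  "equilibrium f e \<longleftrightarrow> f e = 0"

definition lyapunov_stable :: "('a::real_normed_vector \<Rightarrow> 'a) \<Rightarrow> 'a \<Rightarrow> bool" where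
  "lyapunov_stable f e \<longleftrightarrow>
     (\<forall>\<epsilon>>0. \<exists>\<delta>>0. \<forall>x J. solution f x J \<and> dist (x 0) e < \<delta> \<longrightarrow> (\<forall>t\<in>J. dist (x t) e < \<epsilon>))"

text \<open>
  Attraction includes that solutions do not cease to exist in finite time. It is never vacuous:
  \<open>J = {0}\<close> is admitted in \<^const>\<open>solution\<close>, so by Zorn's lemma every initial value has a maximal
  solution.
\<close>

definition attracted :: "('a::real_normed_vector \<Rightarrow> 'a) \<Rightarrow> 'a \<Rightarrow> 'a \<Rightarrow> bool" where
  "attracted f e x0 \<longleftrightarrow>
     (\<forall>x J. maximal_solution f x J \<and> x 0 = x0 \<longrightarrow> J = {0..} \<and> (x \<longlongrightarrow> e) at_top)"

definition locally_asymptotically_stable :: "('a::real_normed_vector \<Rightarrow> 'a) \<Rightarrow> 'a \<Rightarrow> bool" where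
  "locally_asymptotically_stable f e \<longleftrightarrow>
     equilibrium f e \<and> lyapunov_stable f e \<and> (\<exists>\<delta>>0. \<forall>x0. dist x0 e < \<delta> \<longrightarrow> attracted f e x0)"

definition globally_asymptotically_stable :: "('a::real_normed_vector \<Rightarrow> 'a) \<Rightarrow> 'a \<Rightarrow> bool" where
  "globally_asymptotically_stable f e \<longleftrightarrow>
     equilibrium f e \<and> lyapunov_stable f e \<and> (\<forall>x0. attracted f e x0)"

text \<open>
  Uniqueness of the minimum over the whole of \<open>D\<close> already makes it isolated.
\<close>

definition unique_minimum_on :: "('a \<Rightarrow> real) \<Rightarrow> 'a set \<Rightarrow> 'a \<Rightarrow> bool" where
  "unique_minimum_on F D z \<longleftrightarrow>
     is_arg_min F (\<lambda>w. w \<in> D) z \<and> (\<forall>w. is_arg_min F (\<lambda>w. w \<in> D) w \<longrightarrow> w = z)"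

definition system_field ::
  "real \<Rightarrow> real \<Rightarrow> real \<Rightarrow> real \<Rightarrow> ('a::euclidean_space \<Rightarrow> real) \<Rightarrow> 'a \<times> 'a \<Rightarrow> 'a \<times> 'a" where
  "system_field k c1 c2 \<gamma> F = (\<lambda>(z1, z2).
     (z2, - (k *\<^sub>R z2) - c1 *\<^sub>R gradient F z1 - c2 *\<^sub>R gradient F (z1 + \<gamma> *\<^sub>R z2)))"

end

theory Submission
  imports Defs "HOL-Complex_Analysis.Great_Picard"
begin

text \<open>
  Write \<open>g\<close> for the gradient of \<open>F\<close> and \<open>y = z1 + \<gamma> z2\<close>. The energy
  \<open>(c1 + c2) (F z1 - F z*) + |z2|\<^sup>2 / 2\<close> has derivative \<open>- k |z2|\<^sup>2 - c2 z2 \<bullet> (g y - g z1)\<close>, which is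
  nonpositive because \<open>g\<close> is monotone, but it does not see \<open>z1\<close>. For small \<open>\<epsilon> > 0\<close> the perturbation
  \<open>W = (c1 + c2 - \<epsilon> \<gamma> c2) (F z1 - F z*) + |z2|\<^sup>2 / 2 + \<epsilon> (z1 - z*) \<bullet> z2 + \<epsilon> k |z1 - z*|\<^sup>2 / 2\<close> has derivative
  \<open>- (k - \<epsilon>) |z2|\<^sup>2 - c2 (1 - \<epsilon> \<gamma>) z2 \<bullet> (g y - g z1) - \<epsilon> c1 (z1 - z*) \<bullet> g z1 - \<epsilon> c2 (y - z*) \<bullet> g y\<close>,
  which is negative definite. So \<open>W\<close> is a strict Lyapunov function and no invariance principle is
  needed; being bounded below by a definite quadratic form, it also gives the global statement.
  Since \<open>g\<close> is merely continuous, that bounded maximal solutions exist for all time rests on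
  Peano's theorem, obtained from solutions of delayed equations and the Arzela-Ascoli theorem.
\<close>

subsection \<open>Peano's existence theorem\<close>

text \<open>For a negative endpoint \<open>{0..t}\<close> is empty and the integral is 0, so the
  estimate covers all real \<open>s\<close> and \<open>t\<close>. This lets the delayed equation
  start from the constant history \<open>x0\<close> without a case of its own.\<close>

lemma integral_diff_bound:
  fixes g :: "real \<Rightarrow> 'a::euclidean_space"
  assumes g: "continuous_on UNIV g" and M: "\<And>s. norm (g s) \<le> M"
  shows "norm (integral {0..t} g - integral {0..s} g) \<le> M * \<bar>t - s\<bar>"
proof -
  have M0: "0 \<le> M"
    using M[of 0] norm_ge_zero order_trans by blast
  have int: "g integrable_on {a..b}" for a b
    using g by (intro integrable_continuous_real) (auto intro: continuous_on_subset)
  have bound: "norm (integral {a..b} g) \<le> M * (b - a)" if "a \<le> b" for a b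
    using that g M by (intro integral_bound) (auto intro: continuous_on_subset)
  have *: "norm (integral {0..t} g - integral {0..s} g) \<le> M * (t - s)" if "s \<le> t" for s t
  proof (cases "0 \<le> s")
    case True
    then have "integral {0..t} g - integral {0..s} g = integral {s..t} g"
      using Henstock_Kurzweil_Integration.integral_combine[OF True that int] by (simp add: algebra_simps)
    then show ?thesis
      using bound[OF that] by simp
  next
    case False
    show ?thesis
    proof (cases "0 \<le> t")
      case True
      have "norm (integral {0..t} g) \<le> M * (t - 0)"
        using bound[OF True] .
      also have "\<dots> \<le> M * (t - s)"
        using False M0 by (intro mult_left_mono) auto
      finally show ?thesis
        using False by simp
    qed (use False that M0 in auto)
  qed
  show ?thesis
    using *[of s t] *[of t s] by (cases "s \<le> t") (auto simp: norm_minus_commute)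
qed

text \<open>
  The delayed equation is solved by iterating its right-hand side: each iteration fixes the solution
  on a further interval of length \<open>d\<close>.
\<close>

lemma delayed_integral_equation:
  fixes f :: "'a::euclidean_space \<Rightarrow> 'a"
  assumes f: "continuous_on UNIV f" and M: "\<And>x. norm (f x) \<le> M" and "0 < d"
  obtains u where "\<And>s t. norm (u t - u s) \<le> M * \<bar>t - s\<bar>"
    and "\<And>t. t \<le> 1 \<Longrightarrow> u t = x0 + integral {0..t - d} (\<lambda>s. f (u s))"
proof -
  define S where "S v = (\<lambda>t. x0 + integral {0..t - d} (\<lambda>s. f (v s)))" for v :: "real \<Rightarrow> 'a"
  define w where "w n = (S ^^ n) (\<lambda>_. x0)" for n
  have w_Suc: "w (Suc n) t = x0 + integral {0..t - d} (\<lambda>s. f (w n s))" for n t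
    by (simp add: w_def S_def)
  have w0: "w 0 t = x0" for t
    by (simp add: w_def)
  have M0: "0 \<le> M"
    using M[of 0] norm_ge_zero order_trans by blast
  have lip: "norm (w n t - w n s) \<le> M * \<bar>t - s\<bar>" for n s t
  proof (induction n arbitrary: s t)
    case 0
    then show ?case using M0 by (simp add: w0)
  next
    case (Suc n)
    have "M-lipschitz_on UNIV (w n)"
      using Suc M0 by (auto simp: lipschitz_on_def dist_norm)
    then have "continuous_on UNIV (\<lambda>s. f (w n s))"
      by (intro continuous_on_compose2[OF f] lipschitz_on_continuous_on) auto
    from integral_diff_bound[OF this M, of "t - d" "s - d"] show ?case
      by (simp add: w_Suc)
  qed
  have stable: "w (Suc n) t = w n t" if "t \<le> n * d" for n t
    using that
  proof (induction n arbitrary: t)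
    case 0
    then show ?case using \<open>0 < d\<close> by (simp add: w_Suc w0)
  next
    case (Suc n)
    have "integral {0..t - d} (\<lambda>s. f (w (Suc n) s)) = integral {0..t - d} (\<lambda>s. f (w n s))"
      using Suc.prems by (intro integral_cong) (auto simp: algebra_simps intro!: arg_cong[of _ _ f] Suc.IH)
    then show ?case
      by (simp add: w_Suc[of "Suc n"] w_Suc[of n])
  qed
  \<comment> \<open>Only times up to 1 matter: once \<open>n * d\<close> reaches 1, a further
    iteration changes nothing there, so \<open>w n\<close> solves the equation.\<close>
  obtain n :: nat where n: "1 \<le> n * d"
    using \<open>0 < d\<close> ex_less_of_nat_mult less_imp_le by metis
  show thesis
    using that[of "w n"] lip stable[of _ n] n by (simp add: w_Suc)
qed

text \<open>Solutions for the delays \<open>1 / Suc n\<close> are uniformly bounded on the unit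
  interval and share the Lipschitz constant \<open>M\<close>, so Arzela-Ascoli yields a uniformly
  convergent subsequence. As the delays vanish, its limit solves the undelayed integral
  equation.\<close>

lemma peano_bounded:
  fixes f :: "'a::euclidean_space \<Rightarrow> 'a"
  assumes f: "continuous_on UNIV f" and M: "\<And>x. norm (f x) \<le> M"
  obtains u where "u 0 = x0"
    and "\<And>t. t \<in> {0..1} \<Longrightarrow> (u has_vector_derivative f (u t)) (at t within {0..1})"
    and "\<And>t. t \<in> {0..1} \<Longrightarrow> norm (u t - x0) \<le> M * t"
proof -
  define d :: "nat \<Rightarrow> real" where "d n = 1 / Suc n" for n
  have d: "0 < d n" for n
    by (simp add: d_def)
  have d_lim: "d \<longlonglongrightarrow> 0"
    unfolding d_def using LIMSEQ_inverse_real_of_nat by (simp add: inverse_eq_divide)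
  have M0: "0 \<le> M"
    using M[of 0] norm_ge_zero order_trans by blast
  have "\<exists>u. (\<forall>s t. norm (u t - u s) \<le> M * \<bar>t - s\<bar>) \<and>
      (\<forall>t\<le>1. u t = x0 + integral {0..t - d n} (\<lambda>s. f (u s)))" for n
    using delayed_integral_equation[OF f M d[of n], of x0] by metis
  then obtain v where lip: "\<And>n s t. norm (v n t - v n s) \<le> M * \<bar>t - s\<bar>"
    and v: "\<And>n t. t \<le> 1 \<Longrightarrow> v n t = x0 + integral {0..t - d n} (\<lambda>s. f (v n s))"
    by metis
  have v0: "v n 0 = x0" for n
    using v[of 0 n] d[of n] by simp
  have fv: "continuous_on UNIV (\<lambda>s. f (v n s))" for n
  proof -
    have "M-lipschitz_on UNIV (v n)"
      using lip M0 by (auto simp: lipschitz_on_def dist_norm)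
    then show ?thesis
      by (intro continuous_on_compose2[OF f] lipschitz_on_continuous_on) auto
  qed
  have bnd: "norm (v n t) \<le> norm x0 + M" if "t \<in> {0..1}" for n t
  proof -
    have "norm (v n t) \<le> norm x0 + norm (v n t - v n 0)"
      using norm_triangle_sub[of "v n t" x0] by (simp add: v0)
    also have "norm (v n t - v n 0) \<le> M * 1"
      using lip[of n t 0] that M0 mult_left_mono[of t 1 M] by simp
    finally show ?thesis by simp
  qed
  have equi: "\<exists>r>0. \<forall>n s. s \<in> {0..1} \<and> norm (t - s) < r \<longrightarrow> norm (v n t - v n s) < e"
    if "0 < e" for t :: real and e
  proof (intro exI conjI allI impI)
    show "0 < e / (M + 1)"
      using that M0 by simp
    fix n s assume "s \<in> {0..1} \<and> norm (t - s) < e / (M + 1)"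
    then have "\<bar>t - s\<bar> * (M + 1) < e"
      using M0 by (simp add: pos_less_divide_eq)
    moreover have "M * \<bar>t - s\<bar> \<le> \<bar>t - s\<bar> * (M + 1)"
      by (simp add: algebra_simps)
    ultimately show "norm (v n t - v n s) < e"
      using lip[of n t s] by linarith
  qed
  obtain u r where u: "continuous_on {0..1} u" and r: "strict_mono (r :: nat \<Rightarrow> nat)"
    and conv: "\<And>e. 0 < e \<Longrightarrow> \<exists>N. \<forall>n t. n \<ge> N \<and> t \<in> {0..1} \<longrightarrow> norm (v (r n) t - u t) < e"
    by (rule Arzela_Ascoli[of "{0..1::real}" v "norm x0 + M"]) (use bnd equi in auto)
  have lim: "(\<lambda>n. v (r n) t) \<longlonglongrightarrow> u t" if "t \<in> {0..1}" for t
    using conv that by (fastforce simp: LIMSEQ_iff)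
  have fu: "continuous_on {0..1} (\<lambda>s. f (u s))"
    by (intro continuous_on_compose2[OF f u]) auto
  have eq: "u t = x0 + integral {0..t} (\<lambda>s. f (u s))" if t: "t \<in> {0..1}" for t
  proof -
    let ?I = "\<lambda>n. integral {0..t} (\<lambda>s. f (v (r n) s))"
    have I: "?I \<longlonglongrightarrow> integral {0..t} (\<lambda>s. f (u s))"
    proof (rule dominated_convergence(2)[where h = "\<lambda>_. M"])
      show "(\<lambda>s. f (v (r n) s)) integrable_on {0..t}" for n
        using fv by (intro integrable_continuous_real) (auto intro: continuous_on_subset)
      show "(\<lambda>n. f (v (r n) s)) \<longlonglongrightarrow> f (u s)" if "s \<in> {0..t}" for s
        using that t by (intro continuous_on_tendsto_compose[OF f lim]) auto
    qed (use M in auto)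
    \<comment> \<open>Stopping the integral at \<open>t - d (r n)\<close> instead of
      \<open>t\<close> changes it by at most \<open>M * d (r n)\<close>.\<close>
    have "(\<lambda>n. v (r n) t - (x0 + ?I n)) \<longlonglongrightarrow> 0"
    proof (rule Lim_null_comparison)
      show "\<forall>\<^sub>F n in sequentially. norm (v (r n) t - (x0 + ?I n)) \<le> M * d (r n)"
      proof (rule always_eventually, rule allI)
        fix n
        show "norm (v (r n) t - (x0 + ?I n)) \<le> M * d (r n)"
          using integral_diff_bound[OF fv M, of "t - d (r n)" "r n" t] t d[of "r n"]
          by (simp add: v[of t])
      qed
      have "(\<lambda>n. d (r n)) \<longlonglongrightarrow> 0"
        using LIMSEQ_subseq_LIMSEQ[OF d_lim r] by (simp add: o_def)
      from tendsto_mult_left[OF this, of M] show "(\<lambda>n. M * d (r n)) \<longlonglongrightarrow> 0"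
        by simp
    qed
    moreover have "(\<lambda>n. v (r n) t - (x0 + ?I n)) \<longlonglongrightarrow> u t - (x0 + integral {0..t} (\<lambda>s. f (u s)))"
      by (intro tendsto_intros lim t I)
    ultimately have "u t - (x0 + integral {0..t} (\<lambda>s. f (u s))) = 0"
      using LIMSEQ_unique by blast
    then show ?thesis by simp
  qed
  show thesis
  proof
    show "u 0 = x0"
      using eq[of 0] by simp
    show "(u has_vector_derivative f (u t)) (at t within {0..1})" if t: "t \<in> {0..1}" for t
    proof (rule has_vector_derivative_transform[OF t])
      show "((\<lambda>t. x0 + integral {0..t} (\<lambda>s. f (u s))) has_vector_derivative f (u t)) (at t within {0..1})"
        using has_vector_derivative_add[OF has_vector_derivative_const[of x0]
            integral_has_vector_derivative[OF fu t]] by simp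
    qed (use eq in auto)
    show "norm (u t - x0) \<le> M * t" if t: "t \<in> {0..1}" for t
    proof (rule Lim_bounded)
      show "(\<lambda>n. norm (v (r n) t - x0)) \<longlonglongrightarrow> norm (u t - x0)"
        by (intro tendsto_intros lim t)
      show "\<forall>n\<ge>0. norm (v (r n) t - x0) \<le> M * t"
        using lip[of _ t 0] t by (simp add: v0)
    qed
  qed
qed

text \<open>Composing \<open>f\<close> with the projection onto a closed unit ball makes it bounded.
  The solution of the modified equation stays in that ball for a short time, and there the
  projection is the identity.\<close>

theorem peano:
  fixes f :: "'a::euclidean_space \<Rightarrow> 'a"
  assumes f: "continuous_on UNIV f"
  obtains u h where "0 < h" "u 0 = x0" "solution f u {0..h}"
proof -
  let ?P = "closest_point (cball x0 1)"
  have P: "continuous_on UNIV ?P" "?P x \<in> cball x0 1" for x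
    by (auto intro!: continuous_on_closest_point closest_point_in_set simp del: mem_cball)
  have fP: "continuous_on UNIV (\<lambda>x. f (?P x))"
    using P by (intro continuous_on_compose2[OF f]) auto
  have "compact (f ` cball x0 1)"
    by (intro compact_continuous_image continuous_on_subset[OF f]) auto
  then obtain M where M: "\<And>y. y \<in> cball x0 1 \<Longrightarrow> norm (f y) \<le> M"
    by (metis bounded_iff compact_imp_bounded imageI)
  have M0: "0 \<le> M"
    using M[of x0] norm_ge_zero[of "f x0"] by (simp del: norm_ge_zero)
  obtain u where u: "u 0 = x0"
    "\<And>t. t \<in> {0..1} \<Longrightarrow> (u has_vector_derivative f (?P (u t))) (at t within {0..1})"
    "\<And>t. t \<in> {0..1} \<Longrightarrow> norm (u t - x0) \<le> M * t"
    using peano_bounded[OF fP, of M x0] M P(2) by metis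
  \<comment> \<open>\<open>M * h \<le> 1\<close> keeps the solution in the unit ball,
    \<open>h \<le> 1\<close> keeps time in the interval of \<open>peano_bounded\<close>, and adding
    1 covers \<open>M = 0\<close>.\<close>
  define h where "h = 1 / (M + 1)"
  have h: "0 < h" "h \<le> 1" "M * h \<le> 1"
    using M0 by (auto simp: h_def field_simps)
  have "solution f u {0..h}"
    unfolding solution_def
  proof (intro conjI ballI)
    fix t assume t: "t \<in> {0..h}"
    have "norm (u t - x0) \<le> M * h"
      using u(3)[of t] t h mult_left_mono[of t h M] M0 by auto
    then have "u t \<in> cball x0 1"
      using h by (simp add: dist_norm norm_minus_commute)
    then have "?P (u t) = u t"
      by (rule closest_point_self)
    then show "(u has_vector_derivative f (u t)) (at t within {0..h})"
      using u(2)[of t] t h by (auto intro: has_vector_derivative_within_subset)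
  qed (use h in \<open>auto simp: is_interval_cc\<close>)
  then show thesis
    using that h(1) u(1) by blast
qed

subsection \<open>Maximal solutions\<close>

text \<open>By the fundamental theorem of calculus with finitely many exceptions, \<open>y\<close>
  is an integral of the continuous function \<open>f\<close> along \<open>y\<close>. That integral
  is differentiable at the exceptions and, one-sidedly, at the endpoints too.\<close>

lemma has_vector_derivative_within_closed_interval:
  fixes y :: "real \<Rightarrow> 'a::euclidean_space"
  assumes f: "continuous_on UNIV f" and y: "continuous_on {a..b} y" and "finite S"
    and D: "\<And>t. t \<in> {a<..<b} - S \<Longrightarrow> (y has_vector_derivative f (y t)) (at t)"
    and t: "t \<in> {a..b}"
  shows "(y has_vector_derivative f (y t)) (at t within {a..b})"
proof (rule has_vector_derivative_transform[OF t])
  have fy: "continuous_on {a..b} (\<lambda>s. f (y s))"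
    by (intro continuous_on_compose2[OF f y]) auto
  show "((\<lambda>t. y a + integral {a..t} (\<lambda>s. f (y s))) has_vector_derivative f (y t)) (at t within {a..b})"
    using has_vector_derivative_add[OF has_vector_derivative_const[of "y a"]
        integral_has_vector_derivative[OF fy t]] by simp
  show "y s = y a + integral {a..s} (\<lambda>s. f (y s))" if "s \<in> {a..b}" for s
  proof -
    have "((\<lambda>s. f (y s)) has_integral (y s - y a)) {a..s}"
      using that by (intro fundamental_theorem_of_calculus_interior_strong[OF \<open>finite S\<close>]
          continuous_on_subset[OF y] D) auto
    then show ?thesis
      by (simp add: integral_unique)
  qed
qed

lemma solution_continuous_on: "solution f x J \<Longrightarrow> continuous_on J x"
  by (auto simp: solution_def continuous_on_eq_continuous_within intro: has_vector_derivative_continuous)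

lemma solution_Icc:
  assumes "solution f x J" and "t \<in> J"
  shows "{0..t} \<subseteq> J"
proof
  fix s assume "s \<in> {0..t}"
  moreover have "is_interval J" "0 \<in> J"
    using assms(1) by (simp_all add: solution_def)
  ultimately show "s \<in> J"
    using assms(2) mem_is_interval_1_I[of J 0 t s] by simp
qed

lemma solution_interior:
  assumes "solution f x J" and "t \<in> J" and "0 < s" "s < t"
  shows "(x has_vector_derivative f (x s)) (at s)"
proof -
  have "{0..t} \<subseteq> J"
    using solution_Icc assms(1,2) .
  then have "{0<..<t} \<subseteq> J"
    by force
  moreover have "s \<in> {0<..<t}"
    using assms(3,4) by simp
  ultimately have "(x has_vector_derivative f (x s)) (at s within {0<..<t})"
    using assms(1) has_vector_derivative_within_subset unfolding solution_def by blast
  then show ?thesis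
    using assms(3,4) by (simp add: at_within_open[of s "{0<..<t}"])
qed

text \<open>On the compact closure of the range \<open>f\<close> is bounded, so \<open>x\<close> is
  Lipschitz and therefore extends continuously to \<open>b\<close>.\<close>

lemma solution_extend_endpoint:
  fixes f :: "'a::euclidean_space \<Rightarrow> 'a"
  assumes f: "continuous_on UNIV f" and x: "solution f x {0..<b}" and "0 < b"
    and K: "bounded (x ` {0..<b})"
  obtains y where "solution f y {0..b}" "\<And>t. t \<in> {0..<b} \<Longrightarrow> y t = x t"
proof -
  have "compact (f ` closure (x ` {0..<b}))"
    using K by (intro compact_continuous_image continuous_on_subset[OF f]) auto
  then obtain M where M: "\<And>y. y \<in> closure (x ` {0..<b}) \<Longrightarrow> norm (f y) \<le> M"
    by (metis bounded_iff compact_imp_bounded imageI)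
  have Mx: "norm (f (x t)) \<le> M" if "t \<in> {0..<b}" for t
    using M that closure_subset by blast
  have "M-lipschitz_on {0..<b} x"
  proof (rule lipschitz_onI)
    show "0 \<le> M"
      using Mx[of 0] \<open>0 < b\<close> norm_ge_zero[of "f (x 0)"] by (simp del: norm_ge_zero)
    fix s t assume st: "s \<in> {0..<b}" "t \<in> {0..<b}"
    have "norm (x s - x t) \<le> M * norm (s - t)"
    proof (rule differentiable_bound[of "{0..<b}" x "\<lambda>t h. h *\<^sub>R f (x t)"])
      show "(x has_derivative (\<lambda>h. h *\<^sub>R f (x t))) (at t within {0..<b})" if "t \<in> {0..<b}" for t
        using x that by (auto simp: solution_def has_vector_derivative_def)
      show "onorm (\<lambda>h. h *\<^sub>R f (x t)) \<le> M" if "t \<in> {0..<b}" for t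
        using Mx[OF that] by (intro onorm_le) (simp add: mult.commute[of M] mult_left_mono)
    qed (use st in auto)
    then show "dist (x s) (x t) \<le> M * dist s t"
      by (simp add: dist_norm)
  qed
  then obtain y where y: "uniformly_continuous_on (closure {0..<b}) y"
    "\<And>t. t \<in> {0..<b} \<Longrightarrow> x t = y t"
    by (metis lipschitz_on_uniformly_continuous uniformly_continuous_on_extension_on_closure)
  have "closure {0..<b} = {0..b}"
    using \<open>0 < b\<close> by simp
  then have yc: "continuous_on {0..b} y"
    using y(1) uniformly_continuous_imp_continuous by metis
  have "(y has_vector_derivative f (y t)) (at t)" if t: "t \<in> {0<..<b} - {}" for t
  proof -
    have "(x has_vector_derivative f (x t)) (at t)"
      using solution_interior[OF x, of "(t + b) / 2" t] t by auto
    then have "(y has_vector_derivative f (x t)) (at t)"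
      using t y(2) by (elim has_vector_derivative_transform_within_open[of _ _ _ "{0<..<b}"]) auto
    then show ?thesis
      using t y(2)[of t] by simp
  qed
  then have "solution f y {0..b}"
    using has_vector_derivative_within_closed_interval[OF f yc finite.emptyI] \<open>0 < b\<close>
    by (auto simp: solution_def is_interval_cc)
  then show thesis
    using that y(2) by metis
qed

text \<open>Away from the junction \<open>b\<close> each piece provides the derivative;
  \<open>b\<close> itself is the one exceptional point.\<close>

lemma solution_concat:
  fixes f :: "'a::euclidean_space \<Rightarrow> 'a"
  assumes f: "continuous_on UNIV f" and x: "solution f x {0..b}" and u: "solution f u {0..h}"
    and "u 0 = x b" and "0 < h"
  shows "solution f (\<lambda>t. if t \<le> b then x t else u (t - b)) {0..b + h}" (is "solution f ?y _")
proof -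
  have b: "0 \<le> b"
    using x by (auto simp: solution_def)
  have "continuous_on {b..b + h} (\<lambda>t. u (t - b))"
    by (intro continuous_on_compose2[OF solution_continuous_on[OF u]] continuous_intros) auto
  then have "continuous_on ({0..b} \<union> {b..b + h}) ?y"
    using solution_continuous_on[OF x] \<open>u 0 = x b\<close>
    by (intro continuous_on_cases) auto
  then have yc: "continuous_on {0..b + h} ?y"
    using b \<open>0 < h\<close> by (simp add: ivl_disj_un_two_touch)
  have "(?y has_vector_derivative f (?y t)) (at t)" if t: "t \<in> {0<..<b + h} - {b}" for t
  proof (cases "t < b")
    case True
    have "(x has_vector_derivative f (x t)) (at t)"
      using solution_interior[OF x, of b t] t True by auto
    then show ?thesis
      using True by (auto elim!: has_vector_derivative_transform_within_open[of _ _ _ "{..<b}"])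
  next
    case False
    then have "b < t"
      using t by auto
    have "(u has_vector_derivative f (u (t - b))) (at (t - b))"
      using solution_interior[OF u, of h "t - b"] t \<open>b < t\<close> by auto
    then have "((\<lambda>t. u (t - b)) has_vector_derivative f (u (t - b))) (at t)"
      using vector_diff_chain_at[of "\<lambda>t. t - b" 1 t u]
      by (simp add: o_def has_vector_derivative_add_const[of _ "- b" for b, simplified])
    then show ?thesis
      using \<open>b < t\<close> by (auto elim!: has_vector_derivative_transform_within_open[of _ _ _ "{b<..}"])
  qed
  then show ?thesis
    using has_vector_derivative_within_closed_interval[OF f yc, of "{b}"] b \<open>0 < h\<close>
    by (auto simp: solution_def is_interval_cc)
qed

text \<open>A bounded interval \<open>J\<close> would be \<open>{0..b}\<close> or
  \<open>{0..<b}\<close>. Peano's theorem at \<open>x b\<close> extends the solution in the first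
  case, the limit at \<open>b\<close> in the second, and either contradicts maximality.\<close>

theorem maximal_solution_bounded_global:
  fixes f :: "'a::euclidean_space \<Rightarrow> 'a"
  assumes f: "continuous_on UNIV f" and x: "maximal_solution f x J" and K: "bounded (x ` J)"
  shows "J = {0..}"
proof (rule ccontr)
  assume J: "J \<noteq> {0..}"
  have sol: "solution f x J"
    and max: "\<And>y K. solution f y K \<Longrightarrow> J \<subseteq> K \<Longrightarrow> (\<And>t. t \<in> J \<Longrightarrow> y t = x t) \<Longrightarrow> K = J"
    using x unfolding maximal_solution_def by blast+
  have J0: "0 \<in> J" "J \<subseteq> {0..}"
    using sol by (auto simp: solution_def)
  then obtain c where c: "0 \<le> c" "c \<notin> J"
    using J by auto
  have ub: "t < c" if "t \<in> J" for t
    using solution_Icc[OF sol that] c by force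
  then have bdd: "bdd_above J"
    by (meson bdd_aboveI less_imp_le)
  define b where "b = Sup J"
  have Jb: "t \<le> b" if "t \<in> J" for t
    using that bdd by (simp add: b_def cSup_upper)
  have inJ: "t \<in> J" if "0 \<le> t" "t < b" for t
  proof -
    obtain s where "s \<in> J" "t < s"
      using \<open>t < b\<close> less_cSup_iff[OF _ bdd, of t] J0 by (auto simp: b_def)
    then show ?thesis
      using solution_Icc[OF sol \<open>s \<in> J\<close>] that by force
  qed
  show False
  proof (cases "b \<in> J")
    case True
    then have Jeq: "J = {0..b}"
      using Jb inJ J0 by force
    obtain u h where u: "0 < h" "u 0 = x b" "solution f u {0..h}"
      using peano[OF f] by metis
    have "solution f (\<lambda>t. if t \<le> b then x t else u (t - b)) {0..b + h}"
      using solution_concat[OF f _ u(3), of x b] u(1,2) sol Jeq by simp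
    from max[OF this] have "{0..b + h} = J"
      using Jeq u(1) by auto
    then show False
      using Jeq u(1) J0 True by (simp add: Icc_eq_Icc)
  next
    case False
    then have "b \<noteq> 0" "0 \<le> b"
      using J0(1) Jb by auto
    have "t < b" if "t \<in> J" for t
      using Jb[OF that] that False by (cases "t = b") auto
    then have Jeq: "J = {0..<b}"
      using inJ J0(2) by auto
    with \<open>b \<noteq> 0\<close> \<open>0 \<le> b\<close> obtain y where y: "solution f y {0..b}" "\<And>t. t \<in> {0..<b} \<Longrightarrow> y t = x t"
      using solution_extend_endpoint[OF f, of x b] sol K by auto
    have "{0..b} = J"
      by (rule max[OF y(1)]) (use Jeq y(2) in auto)
    then show False
      using False \<open>0 \<le> b\<close> by auto
  qed
qed

subsection \<open>Strict Lyapunov functions\<close>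

lemma solution_shift:
  assumes x: "solution f x {0..}" and "0 \<le> T"
  shows "solution f (\<lambda>s. x (T + s)) {0..}"
  unfolding solution_def
proof (intro conjI ballI)
  fix s :: real assume s: "s \<in> {0..}"
  have "(x has_vector_derivative f (x (T + s))) (at (T + s) within (+) T ` {0..})"
    using x \<open>0 \<le> T\<close> s by (auto simp: solution_def intro: has_vector_derivative_within_subset)
  moreover have "((+) T has_vector_derivative 1) (at s within {0..})"
    by (auto intro!: derivative_eq_intros)
  ultimately show "((\<lambda>s. x (T + s)) has_vector_derivative f (x (T + s))) (at s within {0..})"
    using vector_diff_chain_within[of "(+) T" 1 s "{0..}" x] by (simp add: o_def)
qed (auto simp: is_interval_ci)

text \<open>\<open>w\<close> is the decay rate of \<open>W\<close> along the field. The quadratic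
  lower bound puts an explicit barrier \<open>m * r\<^sup>2\<close> on each sphere of radius
  \<open>r < R\<close>, which grows without bound with \<open>r\<close>.\<close>

locale strict_lyapunov_function =
  fixes f :: "'a::euclidean_space \<Rightarrow> 'a" and e :: 'a and R m :: real
    and W w :: "'a \<Rightarrow> real" and W' :: "'a \<Rightarrow> 'a \<Rightarrow> real"
  assumes f: "continuous_on UNIV f"
    and m: "0 < m" and R: "0 < R"
    and W': "\<And>z. z \<in> ball e R \<Longrightarrow> (W has_derivative W' z) (at z)"
    and w: "\<And>z. z \<in> ball e R \<Longrightarrow> W' z (f z) = - w z"
    and w_cont: "continuous_on (ball e R) w"
    and w_pos: "\<And>z. z \<in> ball e R \<Longrightarrow> z \<noteq> e \<Longrightarrow> 0 < w z"
    and w_e: "w e = 0"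
    and W_e: "W e = 0"
    and W_ge: "\<And>z. z \<in> ball e R \<Longrightarrow> m * (dist z e)\<^sup>2 \<le> W z"
begin

lemma w_nonneg: "z \<in> ball e R \<Longrightarrow> 0 \<le> w z"
  using w_pos w_e by (cases "z = e") (auto intro: less_imp_le)

text \<open>The function \<open>W (x s) + c * s\<close> has derivative
  \<open>c - w (x s) \<le> 0\<close>. Taking \<open>c = 0\<close> gives monotonicity, a positive
  \<open>c\<close> gives linear decay.\<close>

lemma W_decreases:
  assumes x: "solution f x J" and "t \<in> J"
    and ball: "\<And>s. s \<in> {0..t} \<Longrightarrow> x s \<in> ball e R"
    and c: "\<And>s. s \<in> {0..t} \<Longrightarrow> c \<le> w (x s)"
  shows "W (x t) \<le> W (x 0) - c * t"
proof -
  have t0: "0 \<le> t"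
    using x \<open>t \<in> J\<close> by (auto simp: solution_def)
  have xc: "continuous_on {0..t} x"
    using solution_continuous_on[OF x] solution_Icc[OF x \<open>t \<in> J\<close>] continuous_on_subset by blast
  have Wc: "continuous_on (ball e R) W"
    using W' by (auto intro!: continuous_at_imp_continuous_on has_derivative_continuous)
  have "W (x t) + c * t \<le> W (x 0) + c * 0"
  proof (rule DERIV_nonpos_imp_decreasing_open[of 0 t "\<lambda>s. W (x s) + c * s"])
    show "continuous_on {0..t} (\<lambda>s. W (x s) + c * s)"
      using ball by (intro continuous_intros continuous_on_compose2[OF Wc xc]) blast
    fix s assume s: "0 < s" "s < t"
    have "(x has_derivative (\<lambda>h. h *\<^sub>R f (x s))) (at s)"
      using solution_interior[OF x \<open>t \<in> J\<close> s] by (simp add: has_vector_derivative_def)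
    from has_derivative_compose[OF this W'[OF ball]]
    have "((\<lambda>s. W (x s)) has_derivative (\<lambda>h. W' (x s) (h *\<^sub>R f (x s)))) (at s)"
      using s by simp
    moreover have "(\<lambda>h. W' (x s) (h *\<^sub>R f (x s))) = (*) (- w (x s))"
      using linear_cmul[OF has_derivative_linear[OF W'[OF ball]]] w[OF ball] s by (intro ext) simp
    ultimately have "((\<lambda>s. W (x s)) has_real_derivative - w (x s)) (at s)"
      by (simp add: has_field_derivative_def)
    then have "((\<lambda>s. W (x s) + c * s) has_real_derivative - w (x s) + c) (at s)"
      by (auto intro!: derivative_eq_intros)
    moreover have "- w (x s) + c \<le> 0"
      using c[of s] s by simp
    ultimately show "\<exists>y. ((\<lambda>s. W (x s) + c * s) has_real_derivative y) (at s) \<and> y \<le> 0"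
      by blast
  qed (fact t0)
  then show ?thesis by simp
qed

text \<open>At the first time when the distance reaches \<open>r\<close>, the barrier would force
  \<open>W\<close> to be at least \<open>m * r\<^sup>2\<close>, although \<open>W\<close> started
  below this value and cannot have grown.\<close>

lemma trapped:
  assumes x: "solution f x J" and r: "r < R"
    and x0: "dist (x 0) e < r" "W (x 0) < m * r\<^sup>2" and "t \<in> J"
  shows "dist (x t) e < r"
proof (rule ccontr)
  assume "\<not> dist (x t) e < r"
  define A where "A = {s \<in> {0..t}. r \<le> dist (x s) e}"
  have t0: "0 \<le> t"
    using x \<open>t \<in> J\<close> by (auto simp: solution_def)
  have xc: "continuous_on {0..t} x"
    using solution_continuous_on[OF x] solution_Icc[OF x \<open>t \<in> J\<close>] continuous_on_subset by blast
  then have dc: "continuous_on {0..t} (\<lambda>s. dist (x s) e)"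
    by (intro continuous_intros)
  have "closed A"
    unfolding A_def by (intro continuous_on_closed_Collect_le continuous_intros xc)
  moreover have "A = {0..t} \<inter> A"
    by (auto simp: A_def)
  ultimately have "compact A"
    by (metis compact_Icc compact_Int_closed)
  moreover have "t \<in> A"
    using \<open>\<not> dist (x t) e < r\<close> t0 by (simp add: A_def)
  ultimately obtain s where s: "s \<in> A" "\<And>s'. s' \<in> A \<Longrightarrow> s \<le> s'"
    using compact_attains_inf[of A] by blast
  \<comment> \<open>The intermediate value theorem gives a time up to \<open>s\<close> with distance
    exactly \<open>r\<close>; minimality of \<open>s\<close> makes it \<open>s\<close>
    itself.\<close>
  obtain s' where s': "0 \<le> s'" "s' \<le> s" "dist (x s') e = r"
    using IVT'[of "\<lambda>s. dist (x s) e" 0 r s] s(1) x0(1) continuous_on_subset[OF dc, of "{0..s}"]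
    by (auto simp: A_def)
  then have "s' \<in> A"
    using s(1) by (simp add: A_def)
  then have "s' = s"
    using s(2) s'(2) by force
  have le: "dist (x u) e \<le> r" if "u \<in> {0..s}" for u
  proof (cases "u = s")
    case False
    then have "u \<notin> A"
      using s(2)[of u] that by auto
    then show ?thesis
      using that s(1) by (auto simp: A_def)
  qed (use s' \<open>s' = s\<close> in simp)
  then have ball: "x u \<in> ball e R" if "u \<in> {0..s}" for u
    using le[OF that] r by (simp add: dist_commute)
  have sJ: "s \<in> J"
    using s(1) solution_Icc[OF x \<open>t \<in> J\<close>] by (auto simp: A_def)
  have "W (x s) \<le> W (x 0) - 0 * s"
    using ball w_nonneg by (intro W_decreases[OF x sJ]) auto
  moreover have "m * r\<^sup>2 \<le> W (x s)"
    using W_ge[OF ball[of s]] s' \<open>s' = s\<close> by simp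
  ultimately show False
    using x0(2) by simp
qed

lemma small_W:
  assumes "0 < r"
  obtains \<delta> where "0 < \<delta>" "\<And>z. dist z e < \<delta> \<Longrightarrow> dist z e < r \<and> W z < m * r\<^sup>2"
proof -
  have "isCont W e"
    using W'[of e] R has_derivative_continuous by auto
  moreover have "0 < m * r\<^sup>2"
    using m assms by simp
  ultimately obtain d where d: "0 < d" "\<And>z. dist z e < d \<Longrightarrow> dist (W z) (W e) < m * r\<^sup>2"
    unfolding continuous_at_eps_delta by metis
  show thesis
  proof (rule that[of "min d r"])
    show "dist z e < r \<and> W z < m * r\<^sup>2" if "dist z e < min d r" for z
      using d(2)[of z] that by (auto simp: W_e dist_real_def)
  qed (use d assms in auto)
qed

lemma stable: "lyapunov_stable f e"
  unfolding lyapunov_stable_def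
proof (intro allI impI)
  fix \<epsilon> :: real assume "0 < \<epsilon>"
  define r where "r = min \<epsilon> (R / 2)"
  have r: "0 < r" "r < R" "r \<le> \<epsilon>"
    using \<open>0 < \<epsilon>\<close> R by (auto simp: r_def)
  obtain \<delta> where \<delta>: "0 < \<delta>" "\<And>z. dist z e < \<delta> \<Longrightarrow> dist z e < r \<and> W z < m * r\<^sup>2"
    using small_W[OF r(1)] by metis
  have "dist (x t) e < \<epsilon>" if "solution f x J" "dist (x 0) e < \<delta>" "t \<in> J" for x J t
    using trapped[OF that(1) r(2) _ _ that(3)] \<delta>(2)[OF that(2)] r(3) by auto
  then show "\<exists>\<delta>>0. \<forall>x J. solution f x J \<and> dist (x 0) e < \<delta> \<longrightarrow> (\<forall>t\<in>J. dist (x t) e < \<epsilon>)"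
    using \<delta>(1) by blast
qed

text \<open>Otherwise the solution remains in a compact shell avoiding \<open>e\<close>, where
  \<open>w\<close> has a positive minimum. Then \<open>W\<close> falls at least linearly and becomes
  negative.\<close>

lemma enters_neighbourhood:
  assumes x: "solution f x {0..}" and r: "r < R" and trap: "\<And>t. 0 \<le> t \<Longrightarrow> dist (x t) e < r"
    and "0 < \<delta>"
  obtains T where "0 \<le> T" "dist (x T) e < \<delta>"
proof (rule ccontr)
  note reached = that
  assume "\<not> thesis"
  then have far: "\<delta> \<le> dist (x t) e" if "0 \<le> t" for t
    using that reached by force
  define K where "K = cball e r - ball e \<delta>"
  have K: "x t \<in> K" if "0 \<le> t" for t
    using trap[OF that] far[OF that] by (simp add: K_def dist_commute)
  have KR: "K \<subseteq> ball e R" "e \<notin> K"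
    using r \<open>0 < \<delta>\<close> by (auto simp: K_def)
  have "compact K"
    by (auto simp: K_def intro: compact_diff)
  then obtain z where z: "z \<in> K" "\<And>y. y \<in> K \<Longrightarrow> w z \<le> w y"
    using continuous_attains_inf[of K w] K[of 0] continuous_on_subset[OF w_cont KR(1)] by auto
  have c: "0 < w z"
    using w_pos[of z] z(1) KR by blast
  have W0: "0 \<le> W y" if "y \<in> K" for y
  proof -
    have "0 \<le> m * (dist y e)\<^sup>2"
      using m by simp
    also have "\<dots> \<le> W y"
      using W_ge that KR by blast
    finally show ?thesis .
  qed
  \<comment> \<open>At this time the linear bound on \<open>W\<close> equals \<open>- w z\<close>,
    already below 0.\<close>
  define t where "t = W (x 0) / w z + 1"
  have t: "0 \<le> t"
    using W0[OF K[of 0]] c by (simp add: t_def)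
  have "W (x t) \<le> W (x 0) - w z * t"
    using t K KR z by (intro W_decreases[OF x]) (auto simp: subset_iff simp del: mem_ball)
  also have "\<dots> = - w z"
    using c by (simp add: t_def field_simps)
  finally show False
    using W0[OF K[OF t]] c by simp
qed

text \<open>Trapping gives boundedness and hence existence for all time. Convergence needs only one
  visit to each small neighbourhood, since stability holds the solution near \<open>e\<close> from
  then on.\<close>

lemma attracted:
  assumes r: "r < R" and x0: "dist x0 e < r" "W x0 < m * r\<^sup>2"
  shows "attracted f e x0"
  unfolding attracted_def
proof (intro allI impI, elim conjE)
  fix x J assume max: "maximal_solution f x J" and init: "x 0 = x0"
  have x: "solution f x J"
    using max by (simp add: maximal_solution_def)
  have trap: "dist (x t) e < r" if "t \<in> J" for t
    using trapped[OF x r _ _ that] x0 init by simp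
  then have "x ` J \<subseteq> ball e r"
    by (auto simp: dist_commute)
  then have J: "J = {0..}"
    using maximal_solution_bounded_global[OF f max] bounded_subset bounded_ball by blast
  have "\<forall>\<^sub>F t in at_top. dist (x t) e < \<epsilon>" if "0 < \<epsilon>" for \<epsilon>
  proof -
    obtain \<delta> where \<delta>: "0 < \<delta>"
      "\<And>y J t. solution f y J \<Longrightarrow> dist (y 0) e < \<delta> \<Longrightarrow> t \<in> J \<Longrightarrow> dist (y t) e < \<epsilon>"
      using stable \<open>0 < \<epsilon>\<close> unfolding lyapunov_stable_def by blast
    obtain T where T: "0 \<le> T" "dist (x T) e < \<delta>"
      using enters_neighbourhood[OF _ r _ \<delta>(1), of x] x trap J by auto
    \<comment> \<open>The equation is autonomous, so the stability estimate restarts at time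
      \<open>T\<close>.\<close>
    have "dist (x t) e < \<epsilon>" if "T \<le> t" for t
      using \<delta>(2)[OF solution_shift[of f x T], of "t - T"] x J T that by simp
    then show ?thesis
      unfolding eventually_at_top_linorder by blast
  qed
  then show "J = {0..} \<and> (x \<longlongrightarrow> e) at_top"
    using J by (simp add: tendsto_iff)
qed

end

subsection \<open>Gradients of convex functions\<close>

text \<open>Restricting \<open>F\<close> to the line through \<open>x\<close> and \<open>y\<close>
  reduces this to the tangent inequality in one variable at parameter 0, evaluated at parameter
  1.\<close>

lemma convex_on_above_tangent_plane:
  fixes F :: "'a::euclidean_space \<Rightarrow> real"
  assumes "open D" and F: "convex_on D F" and g: "GDERIV F x :> g" and x: "x \<in> D" and y: "y \<in> D"
  shows "(y - x) \<bullet> g \<le> F y - F x"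
proof -
  define A where "A = {t. x + t *\<^sub>R (y - x) \<in> D}"
  have "open ((\<lambda>t. x + t *\<^sub>R (y - x)) -` D)"
    by (intro open_vimage \<open>open D\<close> continuous_intros)
  then have "open A"
    by (simp add: A_def vimage_def)
  have comb: "x + (u * s + v * t) *\<^sub>R (y - x) = u *\<^sub>R (x + s *\<^sub>R (y - x)) + v *\<^sub>R (x + t *\<^sub>R (y - x))"
    if "u + v = 1" for u v s t
  proof -
    have "u *\<^sub>R x + v *\<^sub>R x = x"
      using that by (metis scaleR_add_left scaleR_one)
    then show ?thesis
      by (simp add: algebra_simps)
  qed
  have conv: "convex_on A (\<lambda>t. F (x + t *\<^sub>R (y - x)))"
    using F unfolding convex_on_def convex_def A_def by (auto simp: comb)
  have "connected A"
    using conv convex_connected convex_on_imp_convex by blast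
  have "((\<lambda>t. x + t *\<^sub>R (y - x)) has_derivative (\<lambda>h. h *\<^sub>R (y - x))) (at 0)"
    by (auto intro!: derivative_eq_intros)
  from has_derivative_compose[OF this, of F "\<lambda>h. h \<bullet> g"] g
  have "((\<lambda>t. F (x + t *\<^sub>R (y - x))) has_real_derivative (y - x) \<bullet> g) (at 0)"
    by (simp add: gderiv_def has_field_derivative_def mult_commute_abs)
  then have "((y - x) \<bullet> g) * (1 - 0) \<le> F (x + 1 *\<^sub>R (y - x)) - F (x + 0 *\<^sub>R (y - x))"
    using x y \<open>open A\<close>
    by (intro convex_on_imp_above_tangent[OF conv \<open>connected A\<close>])
      (auto simp: A_def interior_open intro: has_field_derivative_at_within)
  then show ?thesis by simp
qed

text \<open>Adding the tangent inequalities at \<open>x\<close> and at \<open>y\<close> cancels the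
  values of \<open>F\<close>.\<close>

lemma convex_on_gradient_monotone:
  fixes F :: "'a::euclidean_space \<Rightarrow> real"
  assumes "open D" "convex_on D F" "GDERIV F x :> gx" "GDERIV F y :> gy" "x \<in> D" "y \<in> D"
  shows "0 \<le> (y - x) \<bullet> (gy - gx)"
  using convex_on_above_tangent_plane[OF assms(1,2,3,5,6)]
    convex_on_above_tangent_plane[OF assms(1,2,4,6,5)]
  by (simp add: inner_diff_left inner_diff_right)

lemma GDERIV_minimum:
  fixes F :: "'a::euclidean_space \<Rightarrow> real"
  assumes "open D" "x \<in> D" "\<And>y. y \<in> D \<Longrightarrow> F x \<le> F y" "GDERIV F x :> g"
  shows "g = 0"
proof -
  have "(\<lambda>h. h \<bullet> g) = (\<lambda>h. 0)"
    using differential_zero_maxmin[OF assms(2,1)] assms(3,4) by (auto simp: gderiv_def)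
  then have "g \<bullet> g = 0"
    by metis
  then show ?thesis by simp
qed

subsection \<open>The Lyapunov function of the system\<close>

lemma system_field_continuous:
  assumes "C1 F"
  shows "continuous_on UNIV (system_field k c1 c2 \<gamma> F)"
proof -
  have "continuous_on UNIV (gradient F)"
    using assms by (simp add: C1_def)
  then show ?thesis
    unfolding system_field_def case_prod_unfold
    by (auto intro!: continuous_intros elim: continuous_on_compose2)
qed

text \<open>Nonnegativity of the square of \<open>2 * \<epsilon> * a + b\<close> bounds the cross
  term below by \<open>- \<epsilon>\<^sup>2 * (a \<bullet> a) - (b \<bullet> b) / 4\<close>, and
  \<open>\<epsilon> \<le> k / 4\<close> makes this cost at most half of each square term.\<close>

lemma quadratic_form_bound:
  fixes a b :: "'a::real_inner"
  assumes "0 < \<epsilon>" "4 * \<epsilon> \<le> k"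
  shows "min (1 / 4) (\<epsilon> * k / 4) * (a \<bullet> a + b \<bullet> b)
    \<le> (b \<bullet> b) / 2 + \<epsilon> * (a \<bullet> b) + \<epsilon> * k / 2 * (a \<bullet> a)"
proof -
  have "0 \<le> ((2 * \<epsilon>) *\<^sub>R a + b) \<bullet> ((2 * \<epsilon>) *\<^sub>R a + b)"
    by simp
  also have "\<dots> = 4 * \<epsilon> * \<epsilon> * (a \<bullet> a) + 4 * \<epsilon> * (a \<bullet> b) + b \<bullet> b"
    by (simp add: algebra_simps inner_commute)
  finally have 1: "- (\<epsilon> * \<epsilon> * (a \<bullet> a)) - (b \<bullet> b) / 4 \<le> \<epsilon> * (a \<bullet> b)"
    by simp
  have 2: "\<epsilon> * \<epsilon> * (a \<bullet> a) \<le> \<epsilon> * k / 4 * (a \<bullet> a)"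
    using assms by (intro mult_right_mono) auto
  have "min (1 / 4) (\<epsilon> * k / 4) * (a \<bullet> a + b \<bullet> b) \<le> \<epsilon> * k / 4 * (a \<bullet> a) + 1 / 4 * (b \<bullet> b)"
    unfolding distrib_left by (intro add_mono mult_right_mono) auto
  then show ?thesis
    using 1 2 by (simp add: field_simps)
qed

text \<open>The functions and \<open>m\<close> are chosen before \<open>R\<close>, so one
  \<open>W\<close> serves every radius. Both \<open>z1\<close> and
  \<open>z1 + \<gamma> *\<^sub>R z2\<close> must lie in \<open>D\<close> because the convexity
  inequalities are applied at both points.\<close>

lemma system_strict_lyapunov_function:
  fixes F :: "'a::euclidean_space \<Rightarrow> real"
  assumes pos: "0 < k" "0 < c1" "0 < c2" "0 < \<gamma>"
    and C1: "C1 F" and D: "open D" and conv: "convex_on D F" and min: "unique_minimum_on F D zs"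
  obtains m W w W' where
    "\<And>R. 0 < R \<Longrightarrow> (\<And>z1 z2. (z1, z2) \<in> ball (zs, 0) R \<Longrightarrow> z1 \<in> D \<and> z1 + \<gamma> *\<^sub>R z2 \<in> D) \<Longrightarrow>
      strict_lyapunov_function (system_field k c1 c2 \<gamma> F) (zs, 0) R m W w W'"
proof -
  let ?g = "gradient F"
  let ?f = "system_field k c1 c2 \<gamma> F"
  have g: "GDERIV F x :> ?g x" for x
    using C1 GDERIV_gradient by (auto simp: C1_def)
  have g_cont: "continuous_on UNIV ?g"
    using C1 by (simp add: C1_def)
  have zs: "zs \<in> D" "\<And>z. z \<in> D \<Longrightarrow> F zs \<le> F z"
    using min by (auto simp: unique_minimum_on_def is_arg_min_linorder)
  have strict: "F zs < F z" if "z \<in> D" "z \<noteq> zs" for z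
  proof (rule ccontr)
    assume "\<not> F zs < F z"
    then have "is_arg_min F (\<lambda>w. w \<in> D) z"
      using zs that by (force simp: is_arg_min_linorder)
    then show False
      using min that by (auto simp: unique_minimum_on_def)
  qed
  have g_zs: "?g zs = 0"
    using GDERIV_minimum[OF D zs(1) zs(2) g] .
  have above: "F z - F zs \<le> (z - zs) \<bullet> ?g z" if "z \<in> D" for z
    using convex_on_above_tangent_plane[OF D conv g that zs(1)] by (simp add: algebra_simps)
  \<comment> \<open>The bound \<open>k / 4\<close> makes the quadratic part of \<open>W\<close>
    definite and \<open>k - \<epsilon>\<close> positive; the bound \<open>1 / (2 * \<gamma>)\<close>
    keeps \<open>1 - \<epsilon> * \<gamma>\<close> positive.\<close>
  define \<epsilon> where "\<epsilon> = min (k / 4) (1 / (2 * \<gamma>))"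
  have "\<epsilon> \<le> 1 / (2 * \<gamma>)"
    by (simp add: \<epsilon>_def)
  from mult_right_mono[OF this, of "2 * \<gamma>"] have "\<epsilon> * (2 * \<gamma>) \<le> 1"
    using pos by simp
  then have \<epsilon>: "0 < \<epsilon>" "4 * \<epsilon> \<le> k" "\<epsilon> * \<gamma> < 1"
    using pos by (auto simp: \<epsilon>_def)
  define a where "a = c1 + c2 * (1 - \<epsilon> * \<gamma>)"
  have a: "0 < a"
    using pos \<epsilon> by (simp add: a_def add_pos_pos)
  text \<open>
    The term \<open>- \<epsilon> * \<gamma> * c2\<close> in the weight of \<open>F\<close> cancels the indefinite part \<open>z2 \<bullet> ?g z1\<close> of
    \<open>\<gamma> * (z2 \<bullet> ?g y)\<close>, which arises on replacing \<open>(z1 - zs) \<bullet> ?g y\<close> by \<open>(y - zs) \<bullet> ?g y\<close> for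
    \<open>y = z1 + \<gamma> *\<^sub>R z2\<close>.
  \<close>
  define W where "W z = a * (F (fst z) - F zs) + ((snd z \<bullet> snd z) / 2 + \<epsilon> * ((fst z - zs) \<bullet> snd z)
    + \<epsilon> * k / 2 * ((fst z - zs) \<bullet> (fst z - zs)))" for z :: "'a \<times> 'a"
  define W' where "W' z h = a * (fst h \<bullet> ?g (fst z)) + (snd z \<bullet> snd h
    + \<epsilon> * (fst h \<bullet> snd z + (fst z - zs) \<bullet> snd h) + \<epsilon> * k * ((fst z - zs) \<bullet> fst h))" for z h :: "'a \<times> 'a"
  define w where "w z = (let y = fst z + \<gamma> *\<^sub>R snd z in
    (k - \<epsilon>) * (snd z \<bullet> snd z) + c2 * (1 - \<epsilon> * \<gamma>) * (snd z \<bullet> (?g y - ?g (fst z)))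
    + \<epsilon> * c1 * ((fst z - zs) \<bullet> ?g (fst z)) + \<epsilon> * c2 * ((y - zs) \<bullet> ?g y))" for z :: "'a \<times> 'a"
  define m where "m = min (1 / 4) (\<epsilon> * k / 4)"
  show thesis
  proof (rule that[of m W w W'])
    fix R :: real assume R: "0 < R"
      and ball: "\<And>z1 z2. (z1, z2) \<in> ball (zs, 0) R \<Longrightarrow> z1 \<in> D \<and> z1 + \<gamma> *\<^sub>R z2 \<in> D"
    show "strict_lyapunov_function ?f (zs, 0) R m W w W'"
    proof
      show "continuous_on UNIV ?f"
        using C1 by (rule system_field_continuous)
      show "0 < m"
        using pos \<epsilon> by (simp add: m_def)
      show "0 < R"
        by fact
      show "(W has_derivative W' z) (at z)" for z
      proof -
        have "((\<lambda>z. F (fst z)) has_derivative (\<lambda>h. fst h \<bullet> ?g (fst z))) (at z)"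
          using has_derivative_compose[OF has_derivative_fst[OF has_derivative_ident] g[unfolded gderiv_def]] .
        then show ?thesis
          unfolding W_def W'_def
          by (auto intro!: derivative_eq_intros simp: algebra_simps inner_commute)
      qed
      \<comment> \<open>This is pure algebra: the derivative of the last square in \<open>W\<close>
        cancels the friction part of the derivative of the cross term.\<close>
      show "W' z (?f z) = - w z" for z
        unfolding W'_def w_def system_field_def case_prod_unfold a_def Let_def
        by (simp add: algebra_simps inner_commute)
      show "continuous_on (ball (zs, 0) R) w"
        unfolding w_def Let_def
        by (intro continuous_intros continuous_on_compose2[OF g_cont]) auto
      show "w (zs, 0) = 0"
        by (simp add: w_def g_zs)
      show "W (zs, 0) = 0"
        by (simp add: W_def)
      fix z :: "'a \<times> 'a" assume z: "z \<in> ball (zs, 0) R"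
      define z1 z2 y where "z1 = fst z" and "z2 = snd z" and "y = z1 + \<gamma> *\<^sub>R z2"
      have z_eq: "z = (z1, z2)"
        by (simp add: z1_def z2_def)
      have inD: "z1 \<in> D" "y \<in> D"
        using ball z by (auto simp: z_eq y_def)
      \<comment> \<open>As \<open>y - z1\<close> is \<open>\<gamma> *\<^sub>R z2\<close>,
        monotonicity of the gradient fixes the sign of the coupling term.\<close>
      have "0 \<le> (y - z1) \<bullet> (?g y - ?g z1)"
        using convex_on_gradient_monotone[OF D conv g g inD] .
      then have "0 \<le> \<gamma> * (z2 \<bullet> (?g y - ?g z1))"
        by (simp add: y_def)
      then have t2: "0 \<le> z2 \<bullet> (?g y - ?g z1)"
        using pos by (simp add: zero_le_mult_iff)
      have t3: "0 \<le> (y - zs) \<bullet> ?g y"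
        using above[OF inD(2)] zs(2)[OF inD(2)] by simp
      have t1: "F z1 - F zs \<le> (z1 - zs) \<bullet> ?g z1" "0 \<le> F z1 - F zs"
        using above[OF inD(1)] zs(2)[OF inD(1)] by simp_all
      have w_eq: "w z = (k - \<epsilon>) * (z2 \<bullet> z2) + c2 * (1 - \<epsilon> * \<gamma>) * (z2 \<bullet> (?g y - ?g z1))
          + \<epsilon> * c1 * ((z1 - zs) \<bullet> ?g z1) + \<epsilon> * c2 * ((y - zs) \<bullet> ?g y)"
        by (simp add: w_def y_def z_eq Let_def)
      have nonneg: "0 \<le> c2 * (1 - \<epsilon> * \<gamma>) * (z2 \<bullet> (?g y - ?g z1))"
        "0 \<le> \<epsilon> * c2 * ((y - zs) \<bullet> ?g y)" "0 \<le> (k - \<epsilon>) * (z2 \<bullet> z2)"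
        "0 \<le> \<epsilon> * c1 * ((z1 - zs) \<bullet> ?g z1)"
        using pos \<epsilon> t1 t2 t3 by (auto intro!: mult_nonneg_nonneg)
      \<comment> \<open>With zero velocity, \<open>z1\<close> differs from \<open>zs\<close> and the
        strict minimum makes the \<open>c1\<close> term positive; otherwise the friction term is
        positive.\<close>
      show "0 < w z" if "z \<noteq> (zs, 0)"
      proof (cases "z2 = 0")
        case True
        then have "0 < F z1 - F zs"
          using that strict[OF inD(1)] by (simp add: z_eq)
        then have "0 < \<epsilon> * c1 * ((z1 - zs) \<bullet> ?g z1)"
          using pos \<epsilon> t1 by simp
        then show ?thesis
          using nonneg unfolding w_eq by linarith
      next
        case False
        then have "0 < (k - \<epsilon>) * (z2 \<bullet> z2)"
          using pos \<epsilon> by simp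
        then show ?thesis
          using nonneg unfolding w_eq by linarith
      qed
      have "(dist z (zs, 0))\<^sup>2 = (z1 - zs) \<bullet> (z1 - zs) + z2 \<bullet> z2"
        by (simp add: z_eq dist_Pair_Pair dist_norm power2_norm_eq_inner)
      then have "m * (dist z (zs, 0))\<^sup>2 \<le> (z2 \<bullet> z2) / 2 + \<epsilon> * ((z1 - zs) \<bullet> z2)
          + \<epsilon> * k / 2 * ((z1 - zs) \<bullet> (z1 - zs))"
        using quadratic_form_bound[OF \<epsilon>(1,2), of "z1 - zs" z2] by (simp add: m_def)
      moreover have "0 \<le> a * (F z1 - F zs)"
        using a t1 by simp
      ultimately show "m * (dist z (zs, 0))\<^sup>2 \<le> W z"
        by (simp add: W_def z_eq)
    qed
  qed
qed

lemma system_equilibrium: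
  fixes F :: "'a::euclidean_space \<Rightarrow> real"
  assumes "C1 F" "open D" "unique_minimum_on F D zs"
  shows "equilibrium (system_field k c1 c2 \<gamma> F) (zs, 0)"
proof -
  have "gradient F zs = 0"
    using assms
    by (intro GDERIV_minimum[of D zs F])
      (auto simp: unique_minimum_on_def is_arg_min_linorder C1_def intro: GDERIV_gradient)
  then show ?thesis
    by (simp add: equilibrium_def system_field_def zero_prod_def)
qed

section \<open>Local and global asymptotic stability of the equilibrium\<close>

theorem theorem3:
  fixes F :: "real ^ 'n \<Rightarrow> real" and D :: "(real ^ 'n) set" and zstar :: "real ^ 'n"
    and k c1 c2 \<gamma> :: real
  assumes "k > 0" and "c1 > 0" and "c2 > 0" and "\<gamma> > 0"
    and "C1 F"
    and "open D" and "convex D" and "convex_on D F"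
    and "unique_minimum_on F D zstar"
  shows "locally_asymptotically_stable (system_field k c1 c2 \<gamma> F) (zstar, 0) \<and>
    (D = UNIV \<and> filterlim F at_top at_infinity \<longrightarrow>
      globally_asymptotically_stable (system_field k c1 c2 \<gamma> F) (zstar, 0))"
proof -
  let ?f = "system_field k c1 c2 \<gamma> F" and ?e = "(zstar, 0 :: real ^ 'n)"
  obtain m W w W' where lyap:
    "\<And>R. 0 < R \<Longrightarrow> (\<And>z1 z2. (z1, z2) \<in> ball ?e R \<Longrightarrow> z1 \<in> D \<and> z1 + \<gamma> *\<^sub>R z2 \<in> D) \<Longrightarrow>
      strict_lyapunov_function ?f ?e R m W w W'"
    using system_strict_lyapunov_function[OF assms(1-6,8,9)] by metis
  have eq: "equilibrium ?f ?e"
    using system_equilibrium assms by blast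
  \<comment> \<open>Openness in the product space yields a radius on which both points required by
    \<open>lyap\<close> lie in \<open>D\<close>.\<close>
  have openD: "open {z. fst z \<in> D \<and> fst z + \<gamma> *\<^sub>R snd z \<in> D}"
    unfolding Collect_conj_eq
    by (intro open_Int open_vimage[of D, unfolded vimage_def] \<open>open D\<close> continuous_intros)
  have "zstar \<in> D"
    using assms(9) by (simp add: unique_minimum_on_def is_arg_min_linorder)
  then have "?e \<in> {z. fst z \<in> D \<and> fst z + \<gamma> *\<^sub>R snd z \<in> D}"
    by simp
  with openD obtain R where R: "0 < R" "ball ?e R \<subseteq> {z. fst z \<in> D \<and> fst z + \<gamma> *\<^sub>R snd z \<in> D}"
    by (rule openE)
  interpret strict_lyapunov_function ?f ?e R m W w W'
    by (rule lyap) (use R in auto)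
  obtain \<delta> where "0 < \<delta>" "\<And>z. dist z ?e < \<delta> \<Longrightarrow> dist z ?e < R / 2 \<and> W z < m * (R / 2)\<^sup>2"
    using small_W[of "R / 2"] R by auto
  then have "locally_asymptotically_stable ?f ?e"
    unfolding locally_asymptotically_stable_def
    using eq stable attracted[of "R / 2"] R by (intro conjI exI[of _ \<delta>]) auto
  moreover have "globally_asymptotically_stable ?f ?e" if D: "D = UNIV"
    unfolding globally_asymptotically_stable_def
  proof (intro conjI allI eq stable)
    fix z0
    \<comment> \<open>The barrier \<open>m * r\<^sup>2\<close> tends to infinity, so any initial
      point lies below it and inside the sphere for large \<open>r\<close>.\<close>
    have "filterlim (\<lambda>r. m * r\<^sup>2) at_top at_top"
      using m by (intro filterlim_tendsto_pos_mult_at_top[OF tendsto_const] filterlim_pow_at_top filterlim_ident) auto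
    then have "\<forall>\<^sub>F r in at_top. W z0 < m * r\<^sup>2 \<and> dist z0 ?e < r"
      by (intro eventually_conj eventually_gt_at_top) (simp add: filterlim_at_top_dense)
    then obtain r where r: "W z0 < m * r\<^sup>2" "dist z0 ?e < r"
      using eventually_happens'[OF trivial_limit_at_top_linorder] by blast
    then have "0 < r"
      using zero_le_dist order.strict_trans1 by blast
    \<comment> \<open>With \<open>D = UNIV\<close> every radius is admissible for the same
      \<open>W\<close>; \<open>r + 1\<close> leaves room for the strict inequality in
      \<open>attracted\<close>.\<close>
    interpret global: strict_lyapunov_function ?f ?e "r + 1" m W w W'
      by (rule lyap) (use \<open>0 < r\<close> D in auto)
    show "attracted ?f ?e z0"
      using global.attracted[of r z0] r by simp
  qed
  ultimately show ?thesis by blast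
qed

end
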